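(* Let $m$ be a complex number, $x$ an indeterminate, and let $\mathcal{F}_m(n,x)=\sum_{k=0}^n k!\,W_m(n,k)x^k$ be the Tanny-Dowling polynomials. Then, as formal power series in $z$, $$\sum_{n=0}^{\infty}\mathcal{F}_m(n,x)z^n=\cfrac{1}{1-b_0z-\cfrac{\lambda_1z^2}{1-b_1z-\cfrac{\lambda_2z^2}{1-b_2z-\cfrac{\lambda_3z^2}{1-b_3z-\cdots}}}},$$ where $b_n=(2n+1)x+nm+1$ for $n\ge 0$ and $\lambda_n=n^2x(x+m)$ for $n\ge 1$. Consequently, the Hankel transform $h_n=\det\big(\mathcal{F}_m(i+j,x)\big)_{0\le i,j\le n}$ of the sequence $(\mathcal{F}_m(n,x))_{n\ge 0}$ is, for all $n\ge 0$, $$h_n=(x(x+m))^{\binom{n+1}{2}}\prod_{k=0}^n k!^2.$$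
   Context: The Whitney numbers of the second kind of Dowling lattices are $W_m(n,k)=\sum_{i=k}^n\binom{n}{i}m^{i-k}S(i,k)$ (with $0^0=1$), where $S(i,k)$ are the Stirling numbers of the second kind; for $m\ne 0$ this is equivalent to $\sum_{n\ge 0} W_m(n,k)\frac{z^n}{n!}=\frac{e^z}{m^k k!}(e^{mz}-1)^k$, and $W_0(n,k)=\binom{n}{k}$. The infinite continued fraction denotes the limit, in the $z$-adic topology on $\mathbb{C}[x][[z]]$, of its finite truncations. The Hankel transform of a sequence $(a_n)_{n\ge 0}$ is the sequence of determinants $h_n=\det(a_{i+j})_{0\le i,j\le n}$. *)

theory Defs
  imports
    Complex_Main
    "HOL-Combinatorics.Stirling"
    "HOL-Computational_Algebra.Formal_Power_Series"
    "HOL-Computational_Algebra.Polynomial"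
    "Jordan_Normal_Form.Determinant"
begin

definition dowling_whitney2 :: "complex \<Rightarrow> nat \<Rightarrow> nat \<Rightarrow> complex" where
  "dowling_whitney2 m n k =
     (\<Sum>i=k..n. of_nat (n choose i) * m ^ (i - k) * of_nat (Stirling i k))"

abbreviation indet :: "complex poly" where
  "indet \<equiv> [:0, 1:]"

definition tanny_dowling :: "complex \<Rightarrow> nat \<Rightarrow> complex poly" where
  "tanny_dowling m n = (\<Sum>k\<le>n. smult (fact k * dowling_whitney2 m n k) (indet ^ k))"

text \<open>The library's \<open>inverse\<close> on formal power series needs an \<open>inverse\<close> operation on the
  coefficients, which \<open>complex poly\<close> does not have. All series inverted below have constant
  coefficient 1, so that the following is their multiplicative inverse.\<close>

definition fps_recip :: "'a::comm_ring_1 fps \<Rightarrow> 'a fps" where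
  "fps_recip f = fps_right_inverse f 1"

lemma fps_recip_mult: "fps_nth f 0 = 1 \<Longrightarrow> f * fps_recip f = 1"
  unfolding fps_recip_def by (rule fps_right_inverse) simp

text \<open>\<open>jfrac_denom b lam j N\<close> is
  \<open>1 - b\<^sub>j z - lam\<^sub>j\<^sub>+\<^sub>1 z\<^sup>2 / (1 - b\<^sub>j\<^sub>+\<^sub>1 z - \<dots> / (1 - b\<^sub>j\<^sub>+\<^sub>N z))\<close>; the value \<open>lam 0\<close> is never used.\<close>

fun jfrac_denom :: "(nat \<Rightarrow> 'a::comm_ring_1) \<Rightarrow> (nat \<Rightarrow> 'a) \<Rightarrow> nat \<Rightarrow> nat \<Rightarrow> 'a fps" where
  "jfrac_denom b lam j 0 = 1 - fps_const (b j) * fps_X"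
| "jfrac_denom b lam j (Suc N) =
     1 - fps_const (b j) * fps_X
       - fps_const (lam (Suc j)) * fps_X ^ 2 * fps_recip (jfrac_denom b lam (Suc j) N)"

lemma jfrac_denom_nth_0: "fps_nth (jfrac_denom b lam j N) 0 = 1"
  by (cases N) (simp_all add: power2_eq_square mult.assoc)

lemma jfrac_denom_recip: "jfrac_denom b lam j N * fps_recip (jfrac_denom b lam j N) = 1"
  by (intro fps_recip_mult jfrac_denom_nth_0)

definition jfrac_truncation :: "(nat \<Rightarrow> 'a::comm_ring_1) \<Rightarrow> (nat \<Rightarrow> 'a) \<Rightarrow> nat \<Rightarrow> 'a fps" where
  "jfrac_truncation b lam N = fps_recip (jfrac_denom b lam 0 N)"

definition hankel_transform :: "(nat \<Rightarrow> 'a::comm_ring_1) \<Rightarrow> nat \<Rightarrow> 'a" where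
  "hankel_transform a n = det (mat (n + 1) (n + 1) (\<lambda>(i, j). a (i + j)))"

end

theory Submission
  imports Defs
begin

text \<open>The tridiagonal recurrence with weights \<open>b\<close> and \<open>lam\<close> generates a unitriangular (Stieltjes)
  matrix \<open>S\<close>. If \<open>C\<^sub>k\<close> is the generating function of its column \<open>k\<close> and \<open>D\<^sub>k\<close> the \<open>N\<close>-th truncated
  continued fraction denominator starting at level \<open>k\<close>, then \<open>D\<^sub>k C\<^sub>k - z C\<^sub>k\<^sub>-\<^sub>1\<close> (with \<open>1\<close> in place of
  \<open>z C\<^sub>-\<^sub>1\<close>) is divisible by \<open>z\<^sup>N\<^sup>+\<^sup>1\<close>, so the J-fraction converges to \<open>C\<^sub>0\<close>. The recurrence is
  self-adjoint for the weights \<open>lam\<^sub>1 \<dots> lam\<^sub>k\<close>, so the Hankel matrix of column \<open>0\<close> factors as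
  \<open>S diag(lam\<^sub>1 \<dots> lam\<^sub>k) S\<^sup>T\<close>. For the given \<open>b\<close> and \<open>lam\<close>, the entries of \<open>S\<close> are explicit
  combinations of Whitney numbers, and column \<open>0\<close> consists of the Tanny-Dowling polynomials.\<close>

section \<open>Stieltjes matrices and convergence of J-fractions\<close>

fun stieltjes :: "(nat \<Rightarrow> 'a::comm_ring_1) \<Rightarrow> (nat \<Rightarrow> 'a) \<Rightarrow> nat \<Rightarrow> nat \<Rightarrow> 'a" where
  "stieltjes b lam 0 k = (if k = 0 then 1 else 0)"
| "stieltjes b lam (Suc n) k =
     (if k = 0 then 0 else stieltjes b lam n (k - 1)) + b k * stieltjes b lam n k
       + lam (Suc k) * stieltjes b lam n (Suc k)"

lemma stieltjes_eq_0: "n < k \<Longrightarrow> stieltjes b lam n k = 0"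
  by (induction n arbitrary: k) auto

lemma stieltjes_diag: "stieltjes b lam n n = 1"
  by (induction n) (auto simp: stieltjes_eq_0)

lemma fps_column_stieltjes:
  fixes b lam :: "nat \<Rightarrow> 'a::comm_ring_1"
  defines "C \<equiv> \<lambda>k. Abs_fps (\<lambda>n. stieltjes b lam n k)"
  shows "(1 - fps_const (b k) * fps_X) * C k =
    (if k = 0 then 1 else fps_X * C (k - 1)) + fps_const (lam (Suc k)) * fps_X * C (Suc k)"
    (is "?l = ?r")
proof (rule fps_ext)
  fix n show "fps_nth ?l n = fps_nth ?r n"
    by (cases n) (auto simp: C_def left_diff_distrib mult.assoc)
qed

text \<open>Each level of the fraction adds one factor z to the error, so the induction on
  \<open>N\<close> treats all levels \<open>k\<close> at once.\<close>

lemma jfrac_denom_mult_column: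
  fixes b lam :: "nat \<Rightarrow> 'a::comm_ring_1"
  defines "C \<equiv> \<lambda>k. Abs_fps (\<lambda>n. stieltjes b lam n k)"
  shows "fps_X ^ Suc N dvd
    jfrac_denom b lam k N * C k - (if k = 0 then 1 else fps_X * C (k - 1))"
proof (induction N arbitrary: k)
  case 0
  show ?case
    using fps_column_stieltjes[of b k lam] by (simp add: C_def mult.assoc)
next
  case (Suc N)
  define D where "D = jfrac_denom b lam (Suc k) N"
  define E where "E = fps_recip D"
  have DE: "D * E = 1"
    by (simp add: D_def E_def jfrac_denom_recip)
  obtain r where r: "D * C (Suc k) - fps_X * C k = fps_X ^ Suc N * r"
    using Suc.IH[of "Suc k"] by (auto simp: D_def)
  have "jfrac_denom b lam k (Suc N) * C k - (if k = 0 then 1 else fps_X * C (k - 1))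
      = (1 - fps_const (b k) * fps_X) * C k - (if k = 0 then 1 else fps_X * C (k - 1))
        - fps_const (lam (Suc k)) * fps_X ^ 2 * E * C k"
    by (simp add: D_def E_def algebra_simps)
  \<comment> \<open>Multiplying \<open>C (Suc k)\<close> by \<open>D * E = 1\<close> exposes the
    error at level \<open>Suc k\<close>, to which the induction hypothesis applies.\<close>
  also have "\<dots> = fps_const (lam (Suc k)) * fps_X * C (Suc k) * (D * E)
        - fps_const (lam (Suc k)) * fps_X ^ 2 * E * C k"
    unfolding DE using fps_column_stieltjes[of b k lam] by (simp add: C_def)
  also have "\<dots> = fps_const (lam (Suc k)) * fps_X * E * (D * C (Suc k) - fps_X * C k)"
    by (simp add: algebra_simps power2_eq_square)
  also have "\<dots> = fps_X ^ Suc (Suc N) * (fps_const (lam (Suc k)) * E * r)"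
    unfolding r by (simp add: algebra_simps)
  finally show ?case
    by simp
qed

theorem jfrac_truncation_tendsto_stieltjes:
  fixes b lam :: "nat \<Rightarrow> 'a::comm_ring_1"
  shows "jfrac_truncation b lam \<longlonglongrightarrow> Abs_fps (\<lambda>n. stieltjes b lam n 0)"
proof (rule tendsto_fpsI)
  fix n
  define C where "C = Abs_fps (\<lambda>n. stieltjes b lam n 0)"
  have "fps_nth (jfrac_truncation b lam N) n = fps_nth C n" if "n \<le> N" for N
  proof -
    define D E where "D = jfrac_denom b lam 0 N" and "E = fps_recip D"
    have DE: "D * E = 1"
      by (simp add: D_def E_def jfrac_denom_recip)
    obtain r where r: "D * C - 1 = fps_X ^ Suc N * r"
      using jfrac_denom_mult_column[where k = 0 and N = N and b = b and lam = lam]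
      by (auto simp: D_def C_def)
    \<comment> \<open>\<open>E\<close> is the truncation itself, so it agrees with \<open>C\<close>
      modulo z^(N+1).\<close>
    have "C = E * (D * C - 1) + E"
      using DE by (simp add: algebra_simps flip: mult.assoc)
    also have "\<dots> = fps_X ^ Suc N * (E * r) + E"
      unfolding r by (simp only: ac_simps)
    finally have "fps_nth C n = fps_nth E n"
      using that by (simp only: fps_add_nth fps_X_power_mult_nth) simp
    then show ?thesis
      by (simp add: jfrac_truncation_def D_def E_def)
  qed
  then show "\<forall>\<^sub>F N in sequentially.
      fps_nth (jfrac_truncation b lam N) n = fps_nth (Abs_fps (\<lambda>n. stieltjes b lam n 0)) n"
    unfolding C_def eventually_sequentially by blast
qed

section \<open>Hankel determinants\<close>

text \<open>The outer terms of the recurrence swap under an index shift because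
  \<open>L (Suc k) = L k * lam (Suc k)\<close>; \<open>i < M\<close> makes the boundary terms at the
  top vanish.\<close>

lemma stieltjes_shift:
  fixes b lam :: "nat \<Rightarrow> 'a::comm_ring_1"
  defines "L \<equiv> \<lambda>k. \<Prod>i<k. lam (Suc i)"
  assumes "i < M"
  shows "(\<Sum>k\<le>M. stieltjes b lam (Suc i) k * L k * stieltjes b lam j k)
       = (\<Sum>k\<le>M. stieltjes b lam i k * L k * stieltjes b lam (Suc j) k)"
proof -
  let ?S = "stieltjes b lam"
  have L: "L (Suc k) = L k * lam (Suc k)" for k
    by (simp add: L_def)
  have z: "?S i M = 0" "?S i (Suc M) = 0"
    using assms by (simp_all add: stieltjes_eq_0)
  obtain M' where M: "M = Suc M'"
    using assms by (cases M) auto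
  have shift: "(\<Sum>k\<le>M. (if k = 0 then 0 else f k)) = (\<Sum>k\<le>M'. f (Suc k))" for f :: "nat \<Rightarrow> 'a"
    by (simp add: M sum.atMost_Suc_shift del: sum.atMost_Suc)
  have "(\<Sum>k\<le>M. ?S (Suc i) k * L k * ?S j k)
      = (\<Sum>k\<le>M. (if k = 0 then 0 else ?S i (k - 1) * L k * ?S j k))
        + (\<Sum>k\<le>M. b k * ?S i k * L k * ?S j k)
        + (\<Sum>k\<le>M. ?S i (Suc k) * L (Suc k) * ?S j k)"
    unfolding sum.distrib[symmetric] by (rule sum.cong) (auto simp: L algebra_simps)
  also have "(\<Sum>k\<le>M. (if k = 0 then 0 else ?S i (k - 1) * L k * ?S j k))
      = (\<Sum>k\<le>M. ?S i k * L (Suc k) * ?S j (Suc k))"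
    unfolding shift using z by (simp add: M)
  also have "(\<Sum>k\<le>M. ?S i (Suc k) * L (Suc k) * ?S j k)
      = (\<Sum>k\<le>M. (if k = 0 then 0 else ?S i k * L k * ?S j (k - 1)))"
    unfolding shift using z by (simp add: M)
  also have "(\<Sum>k\<le>M. ?S i k * L (Suc k) * ?S j (Suc k)) + (\<Sum>k\<le>M. b k * ?S i k * L k * ?S j k)
        + (\<Sum>k\<le>M. (if k = 0 then 0 else ?S i k * L k * ?S j (k - 1)))
      = (\<Sum>k\<le>M. ?S i k * L k * ?S (Suc j) k)"
    unfolding sum.distrib[symmetric] by (rule sum.cong) (auto simp: L algebra_simps)
  finally show ?thesis .
qed

text \<open>Units move from the left row index to the right one until the left row is row 0, where
  only \<open>k = 0\<close> survives.\<close>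

lemma stieltjes_add:
  fixes b lam :: "nat \<Rightarrow> 'a::comm_ring_1"
  assumes "i \<le> M"
  shows "stieltjes b lam (i + j) 0
    = (\<Sum>k\<le>M. stieltjes b lam i k * (\<Prod>i<k. lam (Suc i)) * stieltjes b lam j k)"
  using assms
proof (induction i arbitrary: j)
  case 0
  have "(\<Sum>k\<le>M. stieltjes b lam 0 k * (\<Prod>i<k. lam (Suc i)) * stieltjes b lam j k)
      = (\<Sum>k\<le>M. if k = 0 then stieltjes b lam j 0 else 0)"
    by (rule sum.cong) auto
  then show ?case
    by simp
next
  case (Suc i)
  then show ?case
    using Suc.IH[of "Suc j"] stieltjes_shift[of i M b lam j] by simp
qed

theorem hankel_transform_stieltjes:
  fixes b lam :: "nat \<Rightarrow> 'a::comm_ring_1"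
  shows "hankel_transform (\<lambda>n. stieltjes b lam n 0) n = (\<Prod>k\<le>n. \<Prod>i<k. lam (Suc i))"
proof -
  \<comment> \<open>The weights are absorbed into \<open>A\<close>, and \<open>B\<close> is the
    transposed Stieltjes matrix, so both factors are triangular.\<close>
  define A where "A = mat (n + 1) (n + 1) (\<lambda>(i, k). stieltjes b lam i k * (\<Prod>i<k. lam (Suc i)))"
  define B where "B = mat (n + 1) (n + 1) (\<lambda>(k, j). stieltjes b lam j k)"
  have A: "A \<in> carrier_mat (n + 1) (n + 1)" and B: "B \<in> carrier_mat (n + 1) (n + 1)"
    by (simp_all add: A_def B_def)
  have "mat (n + 1) (n + 1) (\<lambda>(i, j). stieltjes b lam (i + j) 0) = A * B"
  proof (rule eq_matI)
    fix i j assume "i < dim_row (A * B)" "j < dim_col (A * B)"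
    then have ij: "i < n + 1" "j < n + 1"
      using A B by auto
    then have "(A * B) $$ (i, j)
        = (\<Sum>k = 0..<n + 1. stieltjes b lam i k * (\<Prod>i<k. lam (Suc i)) * stieltjes b lam j k)"
      by (simp add: A_def B_def scalar_prod_def)
    also have "{0..<n + 1} = {..n}"
      by auto
    finally show "mat (n + 1) (n + 1) (\<lambda>(i, j). stieltjes b lam (i + j) 0) $$ (i, j) = (A * B) $$ (i, j)"
      using ij stieltjes_add[of i n b lam j] by simp
  qed (use A B in auto)
  then have "hankel_transform (\<lambda>n. stieltjes b lam n 0) n = det A * det B"
    by (simp add: hankel_transform_def det_mult[OF A B])
  also have "det A = (\<Prod>k\<le>n. \<Prod>i<k. lam (Suc i))"
  proof -
    have "det A = prod_list (diag_mat A)"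
      by (rule det_lower_triangular[OF _ A]) (simp add: A_def stieltjes_eq_0)
    also have "\<dots> = (\<Prod>k = 0..<n + 1. \<Prod>i<k. lam (Suc i))"
      unfolding prod_list_diag_prod by (intro prod.cong) (auto simp: A_def stieltjes_diag)
    also have "{0..<n + 1} = {..n}"
      by auto
    finally show ?thesis .
  qed
  also have "det B = 1"
  proof -
    have "upper_triangular B"
      by (auto simp: B_def stieltjes_eq_0)
    then have "det B = prod_list (diag_mat B)"
      by (rule det_upper_triangular[OF _ B])
    also have "\<dots> = 1"
      unfolding prod_list_diag_prod by (intro prod.neutral) (auto simp: B_def stieltjes_diag)
    finally show ?thesis .
  qed
  finally show ?thesis
    by simp
qed

section \<open>Whitney numbers of Dowling lattices\<close>

text \<open>The added terms \<open>i < k\<close> vanish with \<open>Stirling i k\<close>; a range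
  independent of \<open>k\<close> lets sums for different \<open>k\<close> be combined.\<close>

lemma dowling_whitney2_eq_sum_atMost:
  "dowling_whitney2 m n k =
     (\<Sum>i\<le>n. of_nat (n choose i) * m ^ (i - k) * of_nat (Stirling i k))"
  unfolding dowling_whitney2_def by (rule sum.mono_neutral_left) auto

lemma dowling_whitney2_eq_0: "n < k \<Longrightarrow> dowling_whitney2 m n k = 0"
  by (simp add: dowling_whitney2_def)

lemma dowling_whitney2_0 [simp]: "dowling_whitney2 m n 0 = 1"
proof -
  have "dowling_whitney2 m n 0 = (\<Sum>i\<le>n. if i = 0 then 1 else 0)"
    unfolding dowling_whitney2_eq_sum_atMost
  proof (rule sum.cong)
    fix i show "of_nat (n choose i) * m ^ (i - 0) * of_nat (Stirling i 0) = (if i = 0 then 1 else 0)"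
      by (cases i) auto
  qed simp
  then show ?thesis
    by simp
qed

text \<open>Pascal's rule splits the binomial: the part with \<open>n choose Suc i\<close> restores
  the sum for \<open>n\<close>, and the other part expands by the Stirling recurrence in
  \<open>g_Suc\<close>.\<close>

lemma dowling_whitney2_Suc_Suc:
  "dowling_whitney2 m (Suc n) (Suc k)
     = dowling_whitney2 m n k + (1 + of_nat (Suc k) * m) * dowling_whitney2 m n (Suc k)"
proof -
  define g where "g i = m ^ (i - Suc k) * of_nat (Stirling i (Suc k))" for i
  have g_Suc: "g (Suc i) = m ^ (i - k) * of_nat (Stirling i k) + of_nat (Suc k) * m * g i" for i
  \<comment> \<open>For \<open>i \<le> k\<close> the exponents truncate, but then
    \<open>Stirling i (Suc k) = 0\<close>.\<close>
  proof (cases "k < i")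
    case True
    then have "m ^ (i - k) = m * m ^ (i - Suc k)"
      by (simp add: Suc_diff_Suc flip: power_Suc)
    then show ?thesis
      by (simp add: g_def algebra_simps)
  qed (simp add: g_def)
  have "dowling_whitney2 m (Suc n) (Suc k) = (\<Sum>i\<le>Suc n. of_nat (Suc n choose i) * g i)"
    by (simp add: dowling_whitney2_eq_sum_atMost g_def mult.assoc)
  also have "\<dots> = g 0 + (\<Sum>i\<le>n. of_nat (Suc n choose Suc i) * g (Suc i))"
    by (subst sum.atMost_Suc_shift) simp
  also have "\<dots> = (g 0 + (\<Sum>i\<le>n. of_nat (n choose Suc i) * g (Suc i)))
      + (\<Sum>i\<le>n. of_nat (n choose i) * g (Suc i))"
    by (simp add: algebra_simps sum.distrib)
  also have "g 0 + (\<Sum>i\<le>n. of_nat (n choose Suc i) * g (Suc i))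
      = (\<Sum>i\<le>Suc n. of_nat (n choose i) * g i)"
    by (subst sum.atMost_Suc_shift) simp
  also have "\<dots> = dowling_whitney2 m n (Suc k)"
    by (simp add: dowling_whitney2_eq_sum_atMost g_def mult.assoc)
  also have "(\<Sum>i\<le>n. of_nat (n choose i) * g (Suc i))
      = dowling_whitney2 m n k + of_nat (Suc k) * m * dowling_whitney2 m n (Suc k)"
    unfolding g_Suc dowling_whitney2_eq_sum_atMost sum_distrib_left sum.distrib[symmetric]
    by (rule sum.cong) (simp_all add: g_def algebra_simps)
  finally show ?thesis
    by (simp add: algebra_simps)
qed

section \<open>Laguerre-type coefficients\<close>

text \<open>This is \<open>(j! / k!) * (j choose k)\<close>, written without division; it comes from expanding
  \<open>E\<^sup>k / (1 - x E)\<^sup>k\<^sup>+\<^sup>1 / k!\<close> in the terms \<open>x\<^sup>j\<^sup>-\<^sup>k E\<^sup>j / j!\<close>, where \<open>E = (exp (m z) - 1) / m\<close>.\<close>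

definition laguerre_coeff :: "nat \<Rightarrow> nat \<Rightarrow> nat" where
  "laguerre_coeff j k = (j choose k) ^ 2 * fact (j - k)"

lemma laguerre_coeff_eq_0: "j < k \<Longrightarrow> laguerre_coeff j k = 0"
  by (simp add: laguerre_coeff_def)

lemma laguerre_coeff_diag: "laguerre_coeff k k = 1"
  by (simp add: laguerre_coeff_def)

text \<open>The absorption identity for binomials is squared; one of the two factors
  \<open>Suc d\<close> turns \<open>fact d\<close> into \<open>fact (Suc d)\<close>.\<close>

lemma laguerre_coeff_right_Suc:
  "(Suc k)\<^sup>2 * laguerre_coeff (Suc (k + d)) (Suc k) = Suc d * laguerre_coeff (Suc (k + d)) k"
proof -
  have "Suc k * (Suc (k + d) choose Suc k) = Suc d * (Suc (k + d) choose k)"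
    using binomial_absorb_comp[of "Suc (k + d)" k] Suc_times_binomial[of k "k + d"]
    by (simp del: binomial_Suc_Suc mult_Suc mult_Suc_right)
  then have "(Suc k * (Suc (k + d) choose Suc k))\<^sup>2 * fact d
      = (Suc d * (Suc (k + d) choose k))\<^sup>2 * fact d"
    by simp
  then show ?thesis
    by (simp add: laguerre_coeff_def power2_eq_square Suc_diff_le algebra_simps
        del: binomial_Suc_Suc)
qed

text \<open>For \<open>k > 0\<close>, Pascal's rule is squared, and absorption in the form
  \<open>Suc d * Q = k * B\<close> turns the cross term into a multiple of
  \<open>B\<^sup>2\<close>.\<close>

lemma laguerre_coeff_left_Suc:
  "laguerre_coeff (Suc (k + d)) k
     = (if k = 0 then 0 else laguerre_coeff (k + d) (k - 1)) + (2 * k + 1 + d) * laguerre_coeff (k + d) k"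
proof (cases k)
  case 0
  then show ?thesis
    by (simp add: laguerre_coeff_def)
next
  case (Suc l)
  define Q B where "Q = (k + d) choose l" and "B = (k + d) choose k"
  have P: "Suc (k + d) choose k = Q + B"
    by (simp add: Q_def B_def Suc)
  have abs: "Suc d * Q = k * B"
    using binomial_absorb_comp[of "k + d" l] Suc_times_binomial[of l "l + d"]
    by (simp add: Q_def B_def Suc del: binomial_Suc_Suc mult_Suc mult_Suc_right)
  have "Suc d * (Q + B)\<^sup>2 = Suc d * Q\<^sup>2 + 2 * (Suc d * Q) * B + Suc d * B\<^sup>2"
    by (simp add: power2_eq_square algebra_simps)
  also have "\<dots> = Suc d * Q\<^sup>2 + (2 * k + 1 + d) * B\<^sup>2"
    unfolding abs by (simp add: power2_eq_square algebra_simps)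
  finally have "Suc d * (Q + B)\<^sup>2 * fact d = (Suc d * Q\<^sup>2 + (2 * k + 1 + d) * B\<^sup>2) * fact d"
    by simp
  moreover have "k + d - l = Suc d"
    by (simp add: Suc)
  ultimately show ?thesis
    unfolding laguerre_coeff_def P B_def[symmetric]
    by (simp add: Suc_diff_le Suc Q_def algebra_simps)
qed

text \<open>\<open>c\<close> intertwines two recurrences: the left side is the Whitney recurrence
  acting on \<open>j\<close>, the right side the tridiagonal one acting on \<open>k\<close>.\<close>

lemma laguerre_monomial_recurrence:
  fixes x \<mu> :: "'a::comm_ring_1"
  defines "c \<equiv> \<lambda>j k. of_nat (laguerre_coeff j k) * x ^ (j - k)"
  shows "c (Suc j) k + (of_nat j * \<mu> + 1) * c j k
    = (if k = 0 then 0 else c j (k - 1)) + (of_nat (2 * k + 1) * x + (of_nat k * \<mu> + 1)) * c j k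
      + of_nat ((Suc k)\<^sup>2) * x * (x + \<mu>) * c j (Suc k)"
proof -
  \<comment> \<open>The exponent \<open>j - k\<close> truncates on and above the diagonal, so only
    \<open>k < j\<close> is computed generically.\<close>
  consider "j + 1 < k" | "k = Suc j" | "k = j" | d where "j = Suc (k + d)"
  proof -
    have "j + 1 < k \<or> k = Suc j \<or> k = j \<or> k < j"
      by linarith
    then show ?thesis
      using that less_imp_Suc_add by blast
  qed
  then show ?thesis
  proof cases
    case 4
    then have j: "j = k + Suc d"
      by simp
    have 1: "of_nat ((Suc k)\<^sup>2) * x * (x + \<mu>) * c j (Suc k)
        = of_nat (Suc d) * (x + \<mu>) * c j k"
    proof -
      have "of_nat ((Suc k)\<^sup>2) * x * (x + \<mu>) * c j (Suc k)
          = of_nat ((Suc k)\<^sup>2 * laguerre_coeff (Suc (k + d)) (Suc k)) * x * (x + \<mu>) * x ^ d"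
        by (simp add: c_def 4 algebra_simps del: power_Suc)
      also have "\<dots> = of_nat (Suc d * laguerre_coeff (Suc (k + d)) k) * x * (x + \<mu>) * x ^ d"
        by (simp only: laguerre_coeff_right_Suc)
      also have "\<dots> = of_nat (Suc d) * (x + \<mu>) * c j k"
        unfolding of_nat_mult by (simp add: c_def 4 Suc_diff_le mult_ac)
      finally show ?thesis .
    qed
    have 2: "c (Suc j) k = (if k = 0 then 0 else c j (k - 1)) + of_nat (2 * k + 1 + Suc d) * x * c j k"
    proof -
      have "c (Suc j) k = of_nat (laguerre_coeff (Suc (k + Suc d)) k) * x ^ (d + 2)"
        by (simp add: c_def j)
      also have "\<dots> = (if k = 0 then 0 else of_nat (laguerre_coeff (k + Suc d) (k - 1)) * x ^ (d + 2))
          + of_nat (2 * k + 1 + Suc d) * x * (of_nat (laguerre_coeff (k + Suc d) k) * x ^ (d + 1))"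
        unfolding laguerre_coeff_left_Suc by (simp add: algebra_simps)
      finally show ?thesis
        by (cases k) (simp_all add: c_def j del: power_Suc)
    qed
    show ?thesis
      \<comment> \<open>The surplus \<open>Suc d * x\<close> from \<open>2\<close> and
        \<open>Suc d * (x + \<mu>)\<close> from \<open>1\<close> differ by
        \<open>Suc d * \<mu>\<close>, exactly what separates \<open>j * \<mu>\<close> from
        \<open>k * \<mu>\<close>.\<close>
      unfolding 1 2 by (simp add: 4 algebra_simps)
  next
    case 3
    then show ?thesis
      using laguerre_coeff_left_Suc[of k 0]
      by (cases k) (simp_all add: c_def laguerre_coeff_eq_0 algebra_simps)
  qed (auto simp: c_def laguerre_coeff_eq_0 laguerre_coeff_diag)
qed

section \<open>The Stieltjes matrix of the Tanny-Dowling polynomials\<close>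

text \<open>The induction on \<open>n\<close> applies the Whitney recurrence in \<open>j\<close> and
  carries it over to \<open>k\<close> by \<open>laguerre_monomial_recurrence\<close>.\<close>

lemma stieltjes_eq_sum_dowling_whitney2:
  fixes m :: complex and b lam :: "nat \<Rightarrow> complex poly"
  defines "b \<equiv> \<lambda>n. of_nat (2 * n + 1) * indet + [:of_nat n * m + 1:]"
    and "lam \<equiv> \<lambda>n. of_nat (n ^ 2) * indet * (indet + [:m:])"
  shows "stieltjes b lam n k
    = (\<Sum>j\<le>n. [:dowling_whitney2 m n j:] * (of_nat (laguerre_coeff j k) * indet ^ (j - k)))"
proof (induction n arbitrary: k)
  case 0
  then show ?case
    by (cases k) (simp_all add: laguerre_coeff_def flip: one_pCons)
next
  case (Suc n)
  define c where "c j k = of_nat (laguerre_coeff j k) * indet ^ (j - k)" for j k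
  define W where "W n j = [:dowling_whitney2 m n j:]" for n j
  have const: "[:of_nat j * m + 1:] = of_nat j * [:m:] + 1" for j
    by (simp add: of_nat_poly one_pCons)
  have W_Suc: "W (Suc n) (Suc j) = W n j + (of_nat (Suc j) * [:m:] + 1) * W n (Suc j)" for j
    unfolding const[symmetric] W_def dowling_whitney2_Suc_Suc by (simp add: algebra_simps)
  have W0: "W n' 0 = 1" for n'
    by (simp add: W_def one_pCons)
  have "(\<Sum>j\<le>Suc n. W (Suc n) j * c j k)
      = (\<Sum>j\<le>n. W n j * c (Suc j) k)
        + (W n 0 * c 0 k + (\<Sum>j\<le>n. (of_nat (Suc j) * [:m:] + 1) * W n (Suc j) * c (Suc j) k))"
    by (subst sum.atMost_Suc_shift) (simp add: W_Suc W0 distrib_right sum.distrib)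
  also have "W n 0 * c 0 k + (\<Sum>j\<le>n. (of_nat (Suc j) * [:m:] + 1) * W n (Suc j) * c (Suc j) k)
      = (\<Sum>j\<le>Suc n. (of_nat j * [:m:] + 1) * W n j * c j k)"
    by (subst sum.atMost_Suc_shift) simp
  \<comment> \<open>The top term drops out because \<open>W n (Suc n) = 0\<close>.\<close>
  also have "\<dots> = (\<Sum>j\<le>n. (of_nat j * [:m:] + 1) * W n j * c j k)"
    by (simp add: W_def dowling_whitney2_eq_0)
  also have "(\<Sum>j\<le>n. W n j * c (Suc j) k) + \<dots>
      = (\<Sum>j\<le>n. W n j * (c (Suc j) k + (of_nat j * [:m:] + 1) * c j k))"
    by (simp add: sum.distrib algebra_simps)
  also have "\<dots> = (\<Sum>j\<le>n. W n j *
      ((if k = 0 then 0 else c j (k - 1)) + b k * c j k + lam (Suc k) * c j (Suc k)))"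
    unfolding c_def laguerre_monomial_recurrence b_def lam_def const ..
  also have "\<dots> = (if k = 0 then 0 else \<Sum>j\<le>n. W n j * c j (k - 1))
      + b k * (\<Sum>j\<le>n. W n j * c j k) + lam (Suc k) * (\<Sum>j\<le>n. W n j * c j (Suc k))"
    by (simp add: sum.distrib sum_distrib_left algebra_simps)
  also have "\<dots> = stieltjes b lam (Suc n) k"
    by (simp add: Suc.IH W_def c_def)
  finally show ?case
    by (simp only: W_def c_def)
qed

text \<open>In column 0, \<open>laguerre_coeff j 0\<close> is \<open>fact j\<close>, the factorial
  in the Tanny-Dowling coefficients.\<close>

lemma tanny_dowling_eq_stieltjes:
  fixes m :: complex
  shows "tanny_dowling m = (\<lambda>n. stieltjes (\<lambda>n. of_nat (2 * n + 1) * indet + [:of_nat n * m + 1:])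
    (\<lambda>n. of_nat (n ^ 2) * indet * (indet + [:m:])) n 0)"
  unfolding stieltjes_eq_sum_dowling_whitney2 tanny_dowling_def
  by (intro ext sum.cong) (simp_all add: laguerre_coeff_def of_nat_poly)

text \<open>Each inner product is a^k k!^2, and the exponents 0, ..., n add up to
  \<open>(n + 1) choose 2\<close>.\<close>

lemma prod_square_mult_const:
  fixes a :: "'a::{comm_ring_1,semiring_char_0}"
  shows "(\<Prod>k\<le>n. \<Prod>i<k. of_nat ((Suc i)\<^sup>2) * a) = a ^ ((n + 1) choose 2) * (\<Prod>k\<le>n. (fact k)\<^sup>2)"
proof -
  have "(\<Prod>i<k. of_nat ((Suc i)\<^sup>2) * a) = a ^ k * (fact k)\<^sup>2" for k
    by (induction k) (simp_all add: power2_eq_square algebra_simps)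
  then have "(\<Prod>k\<le>n. \<Prod>i<k. of_nat ((Suc i)\<^sup>2) * a) = (\<Prod>k\<le>n. a ^ k) * (\<Prod>k\<le>n. (fact k)\<^sup>2)"
    by (simp add: prod.distrib)
  also have "(\<Prod>k\<le>n. a ^ k) = a ^ ((n + 1) choose 2)"
    by (induction n) (simp_all add: numeral_2_eq_2 power_add)
  finally show ?thesis .
qed

theorem mainTheorem6:
  fixes m :: complex and b lam :: "nat \<Rightarrow> complex poly"
  defines "b \<equiv> \<lambda>n. of_nat (2 * n + 1) * indet + [:of_nat n * m + 1:]"
    and "lam \<equiv> \<lambda>n. of_nat (n ^ 2) * indet * (indet + [:m:])"
  shows "jfrac_truncation b lam \<longlonglongrightarrow> Abs_fps (tanny_dowling m)
    \<and> (\<forall>n. hankel_transform (tanny_dowling m) n =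
          (indet * (indet + [:m:])) ^ ((n + 1) choose 2) * (\<Prod>k\<le>n. fact k ^ 2))"
proof -
  have *: "tanny_dowling m = (\<lambda>n. stieltjes b lam n 0)"
    unfolding b_def lam_def by (rule tanny_dowling_eq_stieltjes)
  have "lam n = of_nat (n\<^sup>2) * (indet * (indet + [:m:]))" for n
    by (simp only: lam_def mult.assoc)
  then show ?thesis
    unfolding * by (simp only: jfrac_truncation_tendsto_stieltjes hankel_transform_stieltjes
        prod_square_mult_const simp_thms)
qed

end
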